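(* Consider the MI-NEP of the context, with all $\theta_\nu$ twice continuously differentiable, and let it be strongly monotone with constant $\mu>0$. Let $\overline\alpha\in(0,1)$ and $\overline{\mathbf x}\in X$ be given, and assume the quantities $\overline\sigma_{\nu\nu'}$, $\nu\neq\nu'$, are finite. Consider the MI-NEP obtained by replacing, for every $\nu\in\mathcal I$, the cost function $\theta_\nu$ by a function $\overline\theta_\nu$ defined in one of the following ways: (i) $\overline\theta_\nu(\mathbf x)=\theta_\nu(\mathbf x)+\frac{\eta_\nu}{2}\|x^\nu-\overline x^\nu\|_2^2$, with $\eta_\nu=\max\left\{\frac{\sum_{\nu'\in\mathcal I\setminus\{\nu\}}\overline\sigma_{\nu\nu'}}{\overline\alpha}-\mu,\ 0\right\}$; (ii) $\overline\theta_\nu(\mathbf x)=\theta_\nu(\mathbf x)+\frac{\rho_\nu}{2}\|x^\nu\|^2_{\nabla^2_{x^\nu x^\nu}\theta_\nu(\overline{\mathbf x})}$, with $\rho_\nu=\max\left\{\frac{\sum_{\nu'\in\mathcal I\setminus\{\nu\}}\overline\sigma_{\nu\nu'}}{\overline\alpha\,\mu}-1,\ 0\right\}$. Then the perturbed MI-NEP is strongly monotone, and its continuous best-response operators $\overline T_\nu(\mathbf x^{-\nu})=\arg\min\{\overline\theta_\nu(x^\nu,\mathbf x^{-\nu}) : x^\nu\in X_\nu\}$ satisfy, for all $\mathbf z,\mathbf y\in X$, $$\max_{\nu\in\mathcal I}\|\overline T_\nu(\mathbf z^{-\nu})-\overline T_\nu(\mathbf y^{-\nu})\|_2\le\overline\alpha\max_{\nu\in\mathcal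 I}\|z^\nu-y^\nu\|_2 .$$
   Context: MI-NEP (mixed-integer Nash equilibrium problem). There are $N$ players, $\mathcal I=\{1,\dots,N\}$. Player $\nu$ controls $x^\nu\in\mathbb R^{n_\nu}$; $\mathbf x=(x^\nu)_{\nu\in\mathcal I}\in\mathbb R^n$, $n=\sum_\nu n_\nu$; $\mathbf x^{-\nu}$ collects the strategies of all players other than $\nu$. Given $\mathbf x^{-\nu}$, player $\nu$ solves $\min_{x^\nu}\theta_\nu(x^\nu,\mathbf x^{-\nu})$ s.t. $x^\nu\in\Omega_\nu=\{x^\nu\in X_\nu\mid x^\nu_j\in\mathbb Z,\ j=1,\dots,i_\nu\}$, where $\theta_\nu:\mathbb R^n\to\mathbb R$ is convex with respect to $x^\nu$, $X_\nu\subseteq\mathbb R^{n_\nu}$ is closed and convex (possibly unbounded), $0\le i_\nu\le n_\nu$ is an integer, and $\Omega_\nu\ne\emptyset$; $X=\prod_\nu X_\nu$. Standing assumptions: each player's problem has a solution for every given $\mathbf x^{-\nu}$, and continuous best responses (minimizers over $X_\nu$) are single-valued. The MI-NEP is called strongly monotone with constant $\mu>0$ if the game mapping $F(\mathbf x)=(\nabla_{x^\nu}\theta_\nu(\mathbf x))_{\nu\in\mathcal I}$ satisfies $(F(\mathbf x)-F(\mathbf y))^\top(\mathbf x-\mathbf y)\ge\mu\|\mathbf x-\mathbf y\|_2^2$ for all $\mathbf x,\mathbf y\in X$. $\overline\sigma_{\nu\nu'}=\sup_{\mathbf x\in X}\|\nabla^2_{x^\nu x^{\nu'}}\theta_\nu(\mathbf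 x)\|_2$ (spectral norm). For a symmetric positive semidefinite matrix $M$, $\|x\|_M^2=x^\top Mx$. *)

theory Defs
  imports "HOL-Analysis.Analysis"
begin

text \<open>
  The players are the elements of the finite type \<open>'p\<close>, and \<open>real^'n\<close> is the space of all
  strategy profiles. Variable \<open>j\<close> of player \<open>\<nu>\<close> (\<open>j = 1, ..., nvar G \<nu>\<close>) is the
  coordinate \<open>coord G \<nu> j\<close> of a profile. Since the dimensions differ between players, the
  strategy space of player \<open>\<nu>\<close> is represented by the subspace of \<open>real^'n\<close> of the vectors
  that vanish outside the coordinates of \<open>\<nu>\<close>; this embedding is isometric. Blocks of matrices
  are zero-padded in the same way, which does not change their spectral norm.
\<close>

record ('p, 'n) game =
  nvar :: "'p \<Rightarrow> nat"
  coord :: "'p \<Rightarrow> nat \<Rightarrow> 'n"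
  nint :: "'p \<Rightarrow> nat"
  feas :: "'p \<Rightarrow> (real^'n) set"
  cost :: "'p \<Rightarrow> real^'n \<Rightarrow> real"

definition vars :: "('p, 'n::finite) game \<Rightarrow> 'p \<Rightarrow> 'n set" where
  "vars G \<nu> = coord G \<nu> ` {1..nvar G \<nu>}"

definition part :: "('p, 'n::finite) game \<Rightarrow> 'p \<Rightarrow> real^'n \<Rightarrow> real^'n" where
  "part G \<nu> x = (\<chi> k. if k \<in> vars G \<nu> then x $ k else 0)"

definition strategies :: "('p, 'n::finite) game \<Rightarrow> 'p \<Rightarrow> (real^'n) set" where
  "strategies G \<nu> = range (part G \<nu>)"

text \<open>The profile in which \<open>\<nu>\<close> plays \<open>u\<close> and all other players play as in \<open>x\<close>.\<close>

definition combine :: "('p, 'n::finite) game \<Rightarrow> 'p \<Rightarrow> real^'n \<Rightarrow> real^'n \<Rightarrow> real^'n" where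
  "combine G \<nu> u x = (\<chi> k. if k \<in> vars G \<nu> then u $ k else x $ k)"

definition profiles :: "('p, 'n::finite) game \<Rightarrow> (real^'n) set" where
  "profiles G = {x. \<forall>\<nu>. part G \<nu> x \<in> feas G \<nu>}"

definition mixed_feas :: "('p, 'n::finite) game \<Rightarrow> 'p \<Rightarrow> (real^'n) set" where
  "mixed_feas G \<nu> = {u \<in> feas G \<nu>. \<forall>j\<in>{1..nint G \<nu>}. u $ coord G \<nu> j \<in> \<int>}"

definition mi_nep :: "('p::finite, 'n::finite) game \<Rightarrow> bool" where
  "mi_nep G \<longleftrightarrow>
     bij_betw (\<lambda>(\<nu>, j). coord G \<nu> j) (SIGMA \<nu>:UNIV. {1..nvar G \<nu>}) UNIV \<and>
     (\<forall>\<nu>. nint G \<nu> \<le> nvar G \<nu> \<and>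
          feas G \<nu> \<subseteq> strategies G \<nu> \<and> closed (feas G \<nu>) \<and> convex (feas G \<nu>) \<and>
          mixed_feas G \<nu> \<noteq> {} \<and>
          (\<forall>x. convex_on (strategies G \<nu>) (\<lambda>u. cost G \<nu> (combine G \<nu> u x))) \<and>
          (\<forall>x\<in>profiles G.
             (\<exists>u. is_arg_min (\<lambda>u. cost G \<nu> (combine G \<nu> u x)) (\<lambda>u. u \<in> mixed_feas G \<nu>) u) \<and>
             (\<exists>!u. is_arg_min (\<lambda>u. cost G \<nu> (combine G \<nu> u x)) (\<lambda>u. u \<in> feas G \<nu>) u)))"

definition best_response :: "('p, 'n::finite) game \<Rightarrow> 'p \<Rightarrow> real^'n \<Rightarrow> real^'n" where
  "best_response G \<nu> x = arg_min_on (\<lambda>u. cost G \<nu> (combine G \<nu> u x)) (feas G \<nu>)"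

definition gradient :: "(real^'n::finite \<Rightarrow> real) \<Rightarrow> real^'n \<Rightarrow> real^'n" where
  "gradient f x = (\<chi> k. frechet_derivative f (at x) (axis k 1))"

definition hessian :: "(real^'n::finite \<Rightarrow> real) \<Rightarrow> real^'n \<Rightarrow> real^'n^'n" where
  "hessian f x = jacobian (gradient f) (at x)"

definition twice_continuously_differentiable :: "(real^'n::finite \<Rightarrow> real) \<Rightarrow> bool" where
  "twice_continuously_differentiable f \<longleftrightarrow>
     f differentiable_on UNIV \<and> gradient f differentiable_on UNIV \<and>
     continuous_on UNIV (hessian f)"

definition game_map :: "('p::finite, 'n::finite) game \<Rightarrow> real^'n \<Rightarrow> real^'n" where
  "game_map G x = (\<Sum>\<nu>\<in>UNIV. part G \<nu> (gradient (cost G \<nu>) x))"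

definition strongly_monotone :: "('p::finite, 'n::finite) game \<Rightarrow> real \<Rightarrow> bool" where
  "strongly_monotone G \<mu> \<longleftrightarrow> \<mu> > 0 \<and>
     (\<forall>x\<in>profiles G. \<forall>y\<in>profiles G.
        (game_map G x - game_map G y) \<bullet> (x - y) \<ge> \<mu> * (norm (x - y))\<^sup>2)"

definition hessian_block ::
    "('p, 'n::finite) game \<Rightarrow> 'p \<Rightarrow> 'p \<Rightarrow> (real^'n \<Rightarrow> real) \<Rightarrow> real^'n \<Rightarrow> real^'n^'n" where
  "hessian_block G \<nu> \<nu>' f x =
     (\<chi> k l. if k \<in> vars G \<nu> \<and> l \<in> vars G \<nu>' then hessian f x $ k $ l else 0)"

definition spectral_norm :: "real^'n^'m \<Rightarrow> real" where
  "spectral_norm A = onorm (\<lambda>v. A *v v)"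

definition coupling_norms :: "('p, 'n::finite) game \<Rightarrow> 'p \<Rightarrow> 'p \<Rightarrow> real set" where
  "coupling_norms G \<nu> \<nu>' =
     (\<lambda>x. spectral_norm (hessian_block G \<nu> \<nu>' (cost G \<nu>) x)) ` profiles G"

text \<open>This is meaningful only if \<open>coupling_norms G \<nu> \<nu>'\<close> is bounded above.\<close>

definition coupling :: "('p, 'n::finite) game \<Rightarrow> 'p \<Rightarrow> 'p \<Rightarrow> real" where
  "coupling G \<nu> \<nu>' = Sup (coupling_norms G \<nu> \<nu>')"

definition quad_form :: "real^'n^'n \<Rightarrow> real^'n \<Rightarrow> real" where
  "quad_form M x = x \<bullet> (M *v x)"

definition proximal_cost ::
    "('p::finite, 'n::finite) game \<Rightarrow> real \<Rightarrow> real \<Rightarrow> real^'n \<Rightarrow> 'p \<Rightarrow> real^'n \<Rightarrow> real" where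
  "proximal_cost G \<mu> \<alpha> xbar \<nu> x =
     (let \<eta> = max ((\<Sum>\<nu>'\<in>UNIV - {\<nu>}. coupling G \<nu> \<nu>') / \<alpha> - \<mu>) 0
      in cost G \<nu> x + \<eta> / 2 * (norm (part G \<nu> x - part G \<nu> xbar))\<^sup>2)"

definition hessian_cost ::
    "('p::finite, 'n::finite) game \<Rightarrow> real \<Rightarrow> real \<Rightarrow> real^'n \<Rightarrow> 'p \<Rightarrow> real^'n \<Rightarrow> real" where
  "hessian_cost G \<mu> \<alpha> xbar \<nu> x =
     (let \<rho> = max ((\<Sum>\<nu>'\<in>UNIV - {\<nu>}. coupling G \<nu> \<nu>') / (\<alpha> * \<mu>) - 1) 0
      in cost G \<nu> x +
         \<rho> / 2 * quad_form (hessian_block G \<nu> \<nu> (cost G \<nu>) xbar) (part G \<nu> x))"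

end

theory Submission
  imports Defs
begin

text \<open>
  Both perturbations add to the cost of player \<open>\<nu>\<close> a quadratic \<open>\<kappa>/2 (x\<^sup>\<nu> - b)\<^sup>T B (x\<^sup>\<nu> - b)\<close> in
  that player's own variables, where \<open>B\<close> is positive semidefinite and bounded below by some
  \<open>m \<ge> 0\<close> on differences of feasible strategies, and \<open>\<kappa>\<close> is chosen such that the sum of the
  couplings of \<open>\<nu>\<close> is at most \<open>\<alpha> (\<mu> + \<kappa> m)\<close>. For the best responses \<open>u\<close> to \<open>z\<close> and \<open>v\<close> to
  \<open>y\<close>, adding the two variational inequalities and using strong monotonicity in the own
  variables gives
  \<open>(\<mu> + \<kappa> m) \<parallel>u - v\<parallel>\<^sup>2 \<le> (\<nabla>\<^sub>\<nu>\<theta>\<^sub>\<nu>(v, y) - \<nabla>\<^sub>\<nu>\<theta>\<^sub>\<nu>(v, z)) \<bullet> (u - v)\<close>,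
  because the gradient of the perturbation depends on \<open>v\<close> alone. By the mean value theorem,
  applied blockwise to the Hessian, the right-hand side is at most the sum of the couplings
  times \<open>max \<parallel>z\<^sup>\<nu> - y\<^sup>\<nu>\<parallel> \<parallel>u - v\<parallel>\<close>.
\<close>

section \<open>Gradients and Hessians\<close>

lemma gradient_has_derivative:
  fixes f :: "real^'n::finite \<Rightarrow> real"
  assumes "f differentiable (at x)"
  shows "(f has_derivative (\<lambda>h. gradient f x \<bullet> h)) (at x)"
proof -
  let ?D = "frechet_derivative f (at x)"
  have D: "(f has_derivative ?D) (at x)"
    using assms by (simp add: frechet_derivative_works)
  then have lin: "linear ?D"
    by (simp add: has_derivative_linear)
  have "?D h = gradient f x \<bullet> h" for h
  proof -
    have "?D h = ?D (\<Sum>k\<in>UNIV. h $ k *\<^sub>R axis k 1)"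
      by (simp add: basis_expansion flip: scalar_mult_eq_scaleR)
    also have "\<dots> = (\<Sum>k\<in>UNIV. h $ k * ?D (axis k 1))"
      by (simp add: linear_sum[OF lin] linear_scale[OF lin])
    finally show ?thesis
      by (simp add: gradient_def inner_vec_def mult.commute)
  qed
  then have "?D = (\<lambda>h. gradient f x \<bullet> h)"
    by (rule ext)
  then show ?thesis
    using D by simp
qed

lemma gradient_eqI:
  fixes f :: "real^'n::finite \<Rightarrow> real"
  assumes "(f has_derivative (\<lambda>h. g \<bullet> h)) (at x)"
  shows "gradient f x = g"
  by (simp add: gradient_def vec_eq_iff inner_axis flip: frechet_derivative_at[OF assms])

lemma has_real_derivative_along_line:
  fixes f :: "real^'n::finite \<Rightarrow> real"
  assumes "\<And>x. (f has_derivative (\<lambda>h. g x \<bullet> h)) (at x)"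
  shows "((\<lambda>t. f (x + t *\<^sub>R d)) has_real_derivative g (x + t *\<^sub>R d) \<bullet> d) (at t)"
proof -
  have "((\<lambda>t. f (x + t *\<^sub>R d)) has_derivative (\<lambda>h. g (x + t *\<^sub>R d) \<bullet> (h *\<^sub>R d))) (at t)"
    by (rule has_derivative_compose[where f = "\<lambda>t. x + t *\<^sub>R d", OF _ assms])
      (auto intro!: derivative_eq_intros)
  then show ?thesis
    by (simp add: has_field_derivative_def mult.commute[of _ "inner _ _"])
qed

text \<open>A vector-valued map has no mean value theorem with a single intermediate point. Pairing
  the gradient with the fixed vector \<open>w\<close> gives a real function of the line parameter,
  to which the scalar theorem applies.\<close>

lemma gradient_increment_eq_hessian:
  fixes f :: "real^'n::finite \<Rightarrow> real"
  assumes "twice_continuously_differentiable f"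
  obtains t where "0 < t" "t < 1"
    and "(gradient f (x + d) - gradient f x) \<bullet> w = w \<bullet> (hessian f (x + t *\<^sub>R d) *v d)"
proof -
  have H: "(gradient f has_derivative (\<lambda>h. hessian f y *v h)) (at y)" for y
    using assms
    by (simp add: twice_continuously_differentiable_def differentiable_on_def
        jacobian_works hessian_def)
  have "((\<lambda>t. gradient f (x + t *\<^sub>R d)) has_derivative
      (\<lambda>h. hessian f (x + t *\<^sub>R d) *v (h *\<^sub>R d))) (at t)" for t
    by (rule has_derivative_compose[where f = "\<lambda>t. x + t *\<^sub>R d", OF _ H])
      (auto intro!: derivative_eq_intros)
  then have "((\<lambda>t. gradient f (x + t *\<^sub>R d) \<bullet> w) has_derivative
      (\<lambda>h. (hessian f (x + t *\<^sub>R d) *v (h *\<^sub>R d)) \<bullet> w)) (at t)" for t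
    by (rule has_derivative_inner_left)
  moreover have "(\<lambda>h. (hessian f (x + t *\<^sub>R d) *v (h *\<^sub>R d)) \<bullet> w) =
      (*) (w \<bullet> (hessian f (x + t *\<^sub>R d) *v d))" for t
    by (simp add: fun_eq_iff matrix_vector_mult_scaleR inner_commute)
  ultimately have deriv: "((\<lambda>t. gradient f (x + t *\<^sub>R d) \<bullet> w) has_real_derivative
      w \<bullet> (hessian f (x + t *\<^sub>R d) *v d)) (at t)" for t
    by (simp add: has_field_derivative_def)
  obtain t where "0 < t" "t < 1"
    and "gradient f (x + 1 *\<^sub>R d) \<bullet> w - gradient f (x + 0 *\<^sub>R d) \<bullet> w
      = (1 - 0) * (w \<bullet> (hessian f (x + t *\<^sub>R d) *v d))"
    using MVT2[of 0 1 "\<lambda>t. gradient f (x + t *\<^sub>R d) \<bullet> w", OF zero_less_one deriv] by blast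
  then show ?thesis
    using that by (simp add: inner_diff_left)
qed

text \<open>Both sides of the monotonicity inequality scale with \<open>s\<^sup>2\<close>. Dividing
  this out leaves the Hessian at an intermediate point near \<open>x\<close>, and continuity of the
  Hessian lets \<open>s\<close> tend to 0. Comparing \<open>x + s a\<close> with
  \<open>x + s b\<close>, instead of with \<open>x\<close> itself, admits directions
  \<open>a - b\<close> that leave the feasible set at \<open>x\<close>.\<close>

lemma hessian_lower_bound:
  fixes f :: "real^'n::finite \<Rightarrow> real"
  assumes f: "twice_continuously_differentiable f"
    and mono: "\<And>s. 0 < s \<Longrightarrow> s \<le> 1 \<Longrightarrow>
      (gradient f (x + s *\<^sub>R a) - gradient f (x + s *\<^sub>R b)) \<bullet> (s *\<^sub>R (a - b))
        \<ge> m * (norm (s *\<^sub>R (a - b)))\<^sup>2"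
  shows "(a - b) \<bullet> (hessian f x *v (a - b)) \<ge> m * (norm (a - b))\<^sup>2"
proof -
  define s where "s n = inverse (real (Suc n))" for n
  have s: "0 < s n" "s n \<le> 1" for n
    by (simp_all add: s_def inverse_le_1_iff)
  have "\<exists>t. 0 < t \<and> t < 1 \<and>
      m * (norm (a - b))\<^sup>2 \<le> (a - b) \<bullet> (hessian f (x + s n *\<^sub>R b + t *\<^sub>R (s n *\<^sub>R (a - b))) *v (a - b))" for n
  proof -
    obtain t where t: "0 < t" "t < 1"
      and eq: "(gradient f (x + s n *\<^sub>R b + s n *\<^sub>R (a - b)) - gradient f (x + s n *\<^sub>R b)) \<bullet> (s n *\<^sub>R (a - b))
        = (s n *\<^sub>R (a - b)) \<bullet> (hessian f (x + s n *\<^sub>R b + t *\<^sub>R (s n *\<^sub>R (a - b))) *v (s n *\<^sub>R (a - b)))"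
      using gradient_increment_eq_hessian[OF f] by metis
    have "x + s n *\<^sub>R b + s n *\<^sub>R (a - b) = x + s n *\<^sub>R a"
      by (simp add: algebra_simps)
    note eq = eq[unfolded this]
    have "(s n)\<^sup>2 * (m * (norm (a - b))\<^sup>2) \<le> (s n)\<^sup>2 *
        ((a - b) \<bullet> (hessian f (x + s n *\<^sub>R b + t *\<^sub>R (s n *\<^sub>R (a - b))) *v (a - b)))"
      using mono[OF s, of n, unfolded eq] s[of n]
      by (simp add: matrix_vector_mult_scaleR power2_eq_square mult_ac)
    then show ?thesis
      using t s[of n] by (auto simp: mult_le_cancel_left)
  qed
  then obtain t where t: "\<And>n. 0 < t n" "\<And>n. t n < 1"
    and le: "\<And>n. m * (norm (a - b))\<^sup>2 \<le>
      (a - b) \<bullet> (hessian f (x + s n *\<^sub>R b + t n *\<^sub>R (s n *\<^sub>R (a - b))) *v (a - b))"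
    by metis
  define p where "p n = x + s n *\<^sub>R b + t n *\<^sub>R (s n *\<^sub>R (a - b))" for n
  have s0: "s \<longlonglongrightarrow> 0"
    unfolding s_def by (rule LIMSEQ_inverse_real_of_nat)
  \<comment> \<open>The intermediate parameters \<open>t n\<close> need not converge, but they stay
    in (0, 1), so the product is dominated by \<open>s n\<close>.\<close>
  have "(\<lambda>n. t n * s n) \<longlonglongrightarrow> 0"
    by (rule Lim_null_comparison[OF _ s0])
      (use t s in \<open>auto intro!: eventuallyI simp: abs_mult less_imp_le mult_left_le_one_le\<close>)
  then have "(\<lambda>n. x + s n *\<^sub>R b + (t n * s n) *\<^sub>R (a - b)) \<longlonglongrightarrow> x + 0 *\<^sub>R b + 0 *\<^sub>R (a - b)"
    by (intro tendsto_intros s0)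
  then have "p \<longlonglongrightarrow> x"
    by (simp add: p_def[abs_def])
  moreover have "isCont (hessian f) x"
    using f by (simp add: twice_continuously_differentiable_def continuous_on_eq_continuous_at)
  ultimately have "(\<lambda>n. hessian f (p n)) \<longlonglongrightarrow> hessian f x"
    by (rule isCont_tendsto_compose[rotated])
  then have "(\<lambda>n. (a - b) \<bullet> (hessian f (p n) *v (a - b))) \<longlonglongrightarrow>
      (a - b) \<bullet> (hessian f x *v (a - b))"
    unfolding matrix_vector_mult_def
    by (intro tendsto_inner tendsto_const vec_tendstoI)
      (auto intro!: tendsto_intros)
  then show ?thesis
    using le by (intro LIMSEQ_le_const) (auto simp: p_def)
qed

section \<open>Strongly convex functions\<close>

text \<open>Along the segment from \<open>u\<close> to \<open>v\<close>, subtract the claimed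
  quadratic lower model from \<open>f\<close>, up to a constant. The difference
  \<open>\<psi>\<close> has nonnegative derivative by strong monotonicity of \<open>g\<close>, and
  the claim is \<open>\<psi> 0 \<le> \<psi> 1\<close>.\<close>

lemma strong_convexity_lower_bound:
  fixes f :: "real^'n::finite \<Rightarrow> real"
  assumes "\<And>x. (f has_derivative (\<lambda>h. g x \<bullet> h)) (at x)"
    and S: "convex S" "u \<in> S" "v \<in> S"
    and mono: "\<And>x y. x \<in> S \<Longrightarrow> y \<in> S \<Longrightarrow> (g x - g y) \<bullet> (x - y) \<ge> c * (norm (x - y))\<^sup>2"
  shows "f v \<ge> f u + g u \<bullet> (v - u) + c / 2 * (norm (v - u))\<^sup>2"
proof -
  define d where "d = v - u"
  define \<psi> where "\<psi> t = f (u + t *\<^sub>R d) - t * (g u \<bullet> d) - c / 2 * t\<^sup>2 * (norm d)\<^sup>2" for t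
  have deriv: "(\<psi> has_real_derivative (g (u + t *\<^sub>R d) - g u) \<bullet> d - c * t * (norm d)\<^sup>2) (at t)" for t
    unfolding \<psi>_def
    by (rule derivative_eq_intros has_real_derivative_along_line assms(1) refl | simp)+
      (simp add: inner_diff_left)
  have "\<psi> 0 \<le> \<psi> 1"
  proof (rule DERIV_nonneg_imp_nondecreasing[where f = \<psi>])
    fix t :: real
    assume t: "0 \<le> t" "t \<le> 1"
    have "(g (u + t *\<^sub>R d) - g u) \<bullet> d - c * t * (norm d)\<^sup>2 \<ge> 0"
    \<comment> \<open>Monotonicity between \<open>u + t d\<close> and \<open>u\<close> yields the
      wanted inequality multiplied by \<open>t\<close>. At \<open>t = 0\<close> both terms
      vanish.\<close>
    proof (cases "t = 0")
      case False
      have "u + t *\<^sub>R d = (1 - t) *\<^sub>R u + t *\<^sub>R v"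
        by (simp add: d_def algebra_simps)
      then have "u + t *\<^sub>R d \<in> S"
        using S t by (simp add: convex_alt)
      from mono[OF this S(2)] have "t * (c * t * (norm d)\<^sup>2) \<le> t * ((g (u + t *\<^sub>R d) - g u) \<bullet> d)"
        by (simp add: power2_eq_square mult_ac)
      then show ?thesis
        using False t by simp
    qed simp
    with deriv show "\<exists>y. (\<psi> has_real_derivative y) (at t) \<and> 0 \<le> y"
      by blast
  qed simp
  then show ?thesis
    by (simp add: \<psi>_def d_def)
qed

text \<open>If the slope from \<open>u\<close> towards \<open>v\<close> were negative, a short step
  in that direction would stay in the convex set and decrease \<open>f\<close>.\<close>

lemma minimizer_variational_inequality:
  fixes f :: "real^'n::finite \<Rightarrow> real"
  assumes "\<And>x. (f has_derivative (\<lambda>h. g x \<bullet> h)) (at x)"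
    and "convex S" "is_arg_min f (\<lambda>u. u \<in> S) u" "v \<in> S"
  shows "g u \<bullet> (v - u) \<ge> 0"
proof (rule ccontr)
  assume "\<not> g u \<bullet> (v - u) \<ge> 0"
  moreover have "((\<lambda>t. f (u + t *\<^sub>R (v - u))) has_real_derivative g u \<bullet> (v - u)) (at 0)"
    using has_real_derivative_along_line[OF assms(1), of u "v - u" 0] by simp
  ultimately obtain \<delta> where "\<delta> > 0"
    and less: "\<And>h. h > 0 \<Longrightarrow> h < \<delta> \<Longrightarrow> f (u + h *\<^sub>R (v - u)) < f u"
    using has_real_derivative_neg_dec_right[of "\<lambda>t. f (u + t *\<^sub>R (v - u))" _ 0 UNIV] by force
  \<comment> \<open>Halving makes \<open>h\<close> strictly smaller than \<open>\<delta>\<close>;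
    the cap 1 keeps the point on the segment from \<open>u\<close> to \<open>v\<close>.\<close>
  define h where "h = min (\<delta> / 2) 1"
  have h: "0 < h" "h < \<delta>" "h \<le> 1"
    using \<open>\<delta> > 0\<close> by (auto simp: h_def)
  have "u + h *\<^sub>R (v - u) = (1 - h) *\<^sub>R u + h *\<^sub>R v"
    by (simp add: algebra_simps)
  then have "u + h *\<^sub>R (v - u) \<in> S"
    using assms h by (simp add: convex_alt is_arg_min_def)
  then show False
    using less[OF h(1,2)] assms(3) by (auto simp: is_arg_min_def)
qed

text \<open>Two sets occur because \<open>K\<close> will also be the mixed-integer feasible set,
  which need not be convex. The quadratic growth of \<open>f\<close> comes from the convex set
  \<open>S\<close>, and it reduces the minimization over the closed set \<open>K\<close> to a
  compact part of it.\<close>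

lemma strongly_convex_minimizer_exists:
  fixes f :: "real^'n::finite \<Rightarrow> real"
  assumes "\<And>x. (f has_derivative (\<lambda>h. g x \<bullet> h)) (at x)"
    and "convex S" "c > 0"
    and "\<And>x y. x \<in> S \<Longrightarrow> y \<in> S \<Longrightarrow> (g x - g y) \<bullet> (x - y) \<ge> c * (norm (x - y))\<^sup>2"
    and K: "closed K" "K \<subseteq> S" "K \<noteq> {}"
  shows "\<exists>u. is_arg_min f (\<lambda>u. u \<in> K) u"
proof -
  obtain a where a: "a \<in> K"
    using K by blast
  \<comment> \<open>Beyond this distance from \<open>a\<close> the term
    \<open>c / 2 * (norm (v - a))\<^sup>2\<close> outweighs the linear term, which is at least
    \<open>- norm (g a) * norm (v - a)\<close>.\<close>
  define r where "r = 2 * norm (g a) / c"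
  have far: "f a < f v" if v: "v \<in> K" "v \<notin> cball a r" for v
  proof -
    have "norm (v - a) > r"
      using v by (simp add: dist_norm norm_minus_commute)
    moreover have "r \<ge> 0"
      using \<open>c > 0\<close> by (simp add: r_def)
    ultimately have pos: "norm (v - a) > 0" and "c / 2 * norm (v - a) > norm (g a)"
      using \<open>c > 0\<close> by (linarith, simp add: r_def field_simps)
    then have "norm (g a) * norm (v - a) < c / 2 * norm (v - a) * norm (v - a)"
      by (simp add: mult_strict_right_mono)
    then have "norm (g a) * norm (v - a) < c / 2 * (norm (v - a))\<^sup>2"
      by (simp add: power2_eq_square mult_ac)
    moreover have "\<bar>g a \<bullet> (v - a)\<bar> \<le> norm (g a) * norm (v - a)"
      by (rule Cauchy_Schwarz_ineq2)
    moreover have "f v \<ge> f a + g a \<bullet> (v - a) + c / 2 * (norm (v - a))\<^sup>2"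
      by (rule strong_convexity_lower_bound[OF assms(1,2) _ _ assms(4)]) (use a v K in auto)
    ultimately show ?thesis
      by linarith
  qed
  have "compact (K \<inter> cball a r)"
    using K by (simp add: closed_Int_compact)
  moreover have "a \<in> K \<inter> cball a r"
    using a \<open>c > 0\<close> by (simp add: r_def)
  moreover have "continuous_on (K \<inter> cball a r) f"
    by (intro continuous_at_imp_continuous_on ballI has_derivative_continuous[OF assms(1)])
  ultimately obtain u where u: "u \<in> K \<inter> cball a r"
    and min: "\<And>v. v \<in> K \<inter> cball a r \<Longrightarrow> f u \<le> f v"
    using continuous_attains_inf[of "K \<inter> cball a r" f] by blast
  have "f u \<le> f v" if "v \<in> K" for v
    using min[of v] min[OF \<open>a \<in> K \<inter> cball a r\<close>] far[OF that] that
    by (cases "v \<in> cball a r") auto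
  then show ?thesis
    using u by (auto simp: is_arg_min_linorder)
qed

text \<open>The variational inequalities of the two minimizers add up to the reverse of strict
  monotonicity.\<close>

lemma strongly_convex_minimizer_unique:
  fixes f :: "real^'n::finite \<Rightarrow> real"
  assumes "\<And>x. (f has_derivative (\<lambda>h. g x \<bullet> h)) (at x)"
    and "convex S" "c > 0"
    and "\<And>x y. x \<in> S \<Longrightarrow> y \<in> S \<Longrightarrow> (g x - g y) \<bullet> (x - y) \<ge> c * (norm (x - y))\<^sup>2"
    and uv: "is_arg_min f (\<lambda>u. u \<in> S) u" "is_arg_min f (\<lambda>u. u \<in> S) v"
  shows "u = v"
proof -
  have S: "u \<in> S" "v \<in> S"
    using uv by (auto simp: is_arg_min_def)
  have "g u \<bullet> (v - u) \<ge> 0" "g v \<bullet> (u - v) \<ge> 0"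
    by (rule minimizer_variational_inequality[OF assms(1,2)] uv S)+
  then have "(g u - g v) \<bullet> (u - v) \<le> 0"
    by (simp add: inner_diff)
  with assms(4)[OF S] have "c * (norm (u - v))\<^sup>2 \<le> 0"
    by linarith
  with \<open>c > 0\<close> have "(norm (u - v))\<^sup>2 \<le> 0"
    by (simp add: mult_le_0_iff)
  then show ?thesis
    by simp
qed

text \<open>The tangent inequalities at the two ends of the segment are added; the function values
  cancel.\<close>

lemma convex_on_line_gradient_monotone:
  fixes f :: "real^'n::finite \<Rightarrow> real"
  assumes "\<And>x. (f has_derivative (\<lambda>h. g x \<bullet> h)) (at x)"
    and convex: "convex_on UNIV (\<lambda>t. f (x + t *\<^sub>R d))"
  shows "(g (x + d) - g x) \<bullet> d \<ge> 0"
proof -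
  have tangent: "f (x + s *\<^sub>R d) - f (x + t *\<^sub>R d) \<ge> g (x + t *\<^sub>R d) \<bullet> d * (s - t)" for s t
    by (rule convex_on_imp_above_tangent[OF convex])
      (use has_real_derivative_along_line[OF assms(1)] in auto)
  show ?thesis
    using tangent[of 0 1] tangent[of 1 0] by (simp add: inner_diff_left)
qed

section \<open>Strategy blocks\<close>

lemma cost_update_simps [simp]:
  "vars (G\<lparr>cost := \<theta>\<rparr>) = vars G"
  "part (G\<lparr>cost := \<theta>\<rparr>) = part G"
  "strategies (G\<lparr>cost := \<theta>\<rparr>) = strategies G"
  "combine (G\<lparr>cost := \<theta>\<rparr>) = combine G"
  "profiles (G\<lparr>cost := \<theta>\<rparr>) = profiles G"
  "mixed_feas (G\<lparr>cost := \<theta>\<rparr>) = mixed_feas G"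
  by (simp_all add: vars_def part_def strategies_def combine_def profiles_def mixed_feas_def
      fun_eq_iff)

lemma bounded_linear_part: "bounded_linear (part G \<nu>)"
  unfolding linear_conv_bounded_linear[symmetric]
  by (rule linearI) (auto simp: part_def vec_eq_iff)

lemmas part_add = linear_add[OF bounded_linear.linear[OF bounded_linear_part]]
lemmas part_diff = linear_diff[OF bounded_linear.linear[OF bounded_linear_part]]
lemmas part_scaleR = linear_scale[OF bounded_linear.linear[OF bounded_linear_part]]

lemma part_inner_commute: "part G \<nu> x \<bullet> y = x \<bullet> part G \<nu> y"
  by (auto simp: part_def inner_vec_def intro!: sum.cong)

lemma part_idem [simp]: "part G \<nu> (part G \<nu> x) = part G \<nu> x"
  by (simp add: part_def vec_eq_iff)

lemma strategies_iff: "u \<in> strategies G \<nu> \<longleftrightarrow> part G \<nu> u = u"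
  by (auto simp: strategies_def intro: range_eqI[OF sym])

lemma convex_strategies: "convex (strategies G \<nu>)"
  by (simp add: convex_alt strategies_iff part_add part_scaleR)

lemma combine_eq: "combine G \<nu> u x = part G \<nu> u + (x - part G \<nu> x)"
  by (simp add: combine_def part_def vec_eq_iff)

text \<open>The map \<open>combine\<close> is affine in \<open>u\<close> with linear part
  \<open>part G \<nu>\<close>. The chain rule and the self-adjointness of this projection turn the
  full gradient into the partial gradient of the player.\<close>

lemma own_cost_has_derivative:
  assumes "\<And>x. f differentiable (at x)"
  shows "((\<lambda>u. f (combine G \<nu> u x)) has_derivative
    (\<lambda>h. part G \<nu> (gradient f (combine G \<nu> u x)) \<bullet> h)) (at u)"
proof -
  have "((\<lambda>u. combine G \<nu> u x) has_derivative part G \<nu>) (at u)"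
    unfolding combine_eq
    by (rule derivative_eq_intros bounded_linear_imp_has_derivative bounded_linear_part refl)+ simp
  from has_derivative_compose[OF this gradient_has_derivative[OF assms]]
  show ?thesis
    by (simp add: part_inner_commute)
qed

lemma hessian_block_mult:
  "hessian_block G \<nu> \<nu>' f x *v d = part G \<nu> (hessian f x *v part G \<nu>' d)"
  by (auto simp: hessian_block_def part_def matrix_vector_mult_def vec_eq_iff intro!: sum.cong)

lemma norm_matrix_vector_mult_le: "norm (A *v x) \<le> spectral_norm A * norm x"
  unfolding spectral_norm_def
  by (rule onorm) (rule matrix_vector_mul_bounded_linear)

section \<open>Quadratic perturbations in the variables of one player\<close>

lemma quad_form_convex_combination:
  "quad_form B ((1 - t) *\<^sub>R u + t *\<^sub>R v) =
    (1 - t) * quad_form B u + t * quad_form B v - t * (1 - t) * quad_form B (u - v)"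
  by (simp add: quad_form_def matrix_vector_right_distrib matrix_vector_mult_diff_distrib
      matrix_vector_mult_scaleR inner_add inner_diff algebra_simps)

text \<open>This is the common form of both perturbations: the identity matrix centred at the own
  part of \<open>xbar\<close>, or the own Hessian block at \<open>xbar\<close> centred at 0.
  Symmetry of \<open>B\<close> is not built in, so its gradient is expressed through
  \<open>B + transpose B\<close>; no symmetry of the Hessian has to be established.\<close>

definition own_quadratic ::
    "('p, 'n::finite) game \<Rightarrow> 'p \<Rightarrow> real \<Rightarrow> real^'n^'n \<Rightarrow> real^'n \<Rightarrow> real^'n \<Rightarrow> real" where
  "own_quadratic G \<nu> \<kappa> B b x = \<kappa> / 2 * quad_form B (part G \<nu> x - b)"

lemma symmetrized_inner:
  fixes B :: "real^'n^'n"
  shows "((B + transpose B) *v x) \<bullet> y = x \<bullet> (B *v y) + y \<bullet> (B *v x)"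
  unfolding matrix_vector_mult_add_rdistrib inner_add_left transpose_matrix_vector dot_lmul_matrix
  by (simp add: inner_commute)

lemma own_quadratic_has_derivative:
  "(own_quadratic G \<nu> \<kappa> B b has_derivative
    (\<lambda>h. ((\<kappa> / 2) *\<^sub>R part G \<nu> ((B + transpose B) *v (part G \<nu> x - b))) \<bullet> h)) (at x)"
proof -
  have w: "((\<lambda>x. part G \<nu> x - b) has_derivative part G \<nu>) (at x)"
    by (rule derivative_eq_intros bounded_linear_imp_has_derivative bounded_linear_part refl)+ simp
  have "((\<lambda>x. B *v (part G \<nu> x - b)) has_derivative (\<lambda>h. B *v part G \<nu> h)) (at x)"
    by (rule bounded_linear.has_derivative[OF matrix_vector_mul_bounded_linear w])
  from has_derivative_mult_right[OF has_derivative_inner[OF w this], of "\<kappa> / 2"]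
  show ?thesis
    unfolding own_quadratic_def[abs_def] quad_form_def inner_scaleR_left part_inner_commute
      symmetrized_inner .
qed

lemma gradient_own_quadratic:
  "gradient (own_quadratic G \<nu> \<kappa> B b) x =
    (\<kappa> / 2) *\<^sub>R part G \<nu> ((B + transpose B) *v (part G \<nu> x - b))"
  by (rule gradient_eqI own_quadratic_has_derivative)+

text \<open>The gradient is affine, so the centre \<open>b\<close> cancels. The quadratic form of
  \<open>B + transpose B\<close> is twice that of \<open>B\<close>, which absorbs the factor
  1/2.\<close>

lemma gradient_own_quadratic_monotone:
  "(gradient (own_quadratic G \<nu> \<kappa> B b) x - gradient (own_quadratic G \<nu> \<kappa> B b) y) \<bullet> (x - y) =
    \<kappa> * quad_form B (part G \<nu> (x - y))"
proof -
  have "gradient (own_quadratic G \<nu> \<kappa> B b) x - gradient (own_quadratic G \<nu> \<kappa> B b) y =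
      (\<kappa> / 2) *\<^sub>R part G \<nu> ((B + transpose B) *v part G \<nu> (x - y))"
    by (simp add: gradient_own_quadratic part_diff matrix_vector_mult_diff_distrib
        scaleR_diff_right)
  then show ?thesis
    by (simp add: part_inner_commute symmetrized_inner quad_form_def
        del: transpose_matrix_vector matrix_vector_mult_add_rdistrib)
qed

text \<open>The convexity gap is a multiple of the form at a difference of two arguments. There the
  centre \<open>b\<close> drops out, so positivity on the block of the player suffices.\<close>

lemma own_quadratic_convex:
  assumes "\<kappa> \<ge> 0" and psd: "\<And>x. quad_form B (part G \<nu> x) \<ge> 0"
  shows "convex_on (strategies G \<nu>) (\<lambda>u. own_quadratic G \<nu> \<kappa> B b (combine G \<nu> u x))"
proof (rule convex_onI)
  fix t u v
  assume t: "0 < t" "t < (1::real)"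
  have q: "own_quadratic G \<nu> \<kappa> B b (combine G \<nu> u x) = \<kappa> / 2 * quad_form B (part G \<nu> u - b)" for u
    by (simp add: own_quadratic_def combine_eq part_add part_diff)
  have "part G \<nu> ((1 - t) *\<^sub>R u + t *\<^sub>R v) - b =
      (1 - t) *\<^sub>R (part G \<nu> u - b) + t *\<^sub>R (part G \<nu> v - b)"
    by (simp add: part_add part_diff part_scaleR algebra_simps)
  moreover have "(part G \<nu> u - b) - (part G \<nu> v - b) = part G \<nu> (u - v)"
    by (simp add: part_diff)
  moreover have "t * (1 - t) * quad_form B (part G \<nu> (u - v)) \<ge> 0"
    using t psd by simp
  ultimately have "quad_form B (part G \<nu> ((1 - t) *\<^sub>R u + t *\<^sub>R v) - b)
      \<le> (1 - t) * quad_form B (part G \<nu> u - b) + t * quad_form B (part G \<nu> v - b)"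
    by (simp only: quad_form_convex_combination)
  from mult_left_mono[OF this, of "\<kappa> / 2"] \<open>\<kappa> \<ge> 0\<close>
  show "own_quadratic G \<nu> \<kappa> B b (combine G \<nu> ((1 - t) *\<^sub>R u + t *\<^sub>R v) x)
      \<le> (1 - t) * own_quadratic G \<nu> \<kappa> B b (combine G \<nu> u x)
        + t * own_quadratic G \<nu> \<kappa> B b (combine G \<nu> v x)"
    by (simp only: q distrib_left mult.left_commute mult_ac)
qed (rule convex_strategies)

section \<open>Strongly monotone games\<close>

locale mi_nep_game =
  fixes G :: "('p::finite, 'n::finite) game"
  assumes mi_nep: "mi_nep G"
begin

lemma vars_disjoint:
  assumes "k \<in> vars G \<nu>" "k \<in> vars G \<nu>'"
  shows "\<nu> = \<nu>'"
proof -
  obtain i j where "i \<in> {1..nvar G \<nu>}" "j \<in> {1..nvar G \<nu>'}" "coord G \<nu> i = coord G \<nu>' j"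
    using assms by (auto simp: vars_def)
  moreover have "inj_on (\<lambda>(\<nu>, j). coord G \<nu> j) (SIGMA \<nu>:UNIV. {1..nvar G \<nu>})"
    using mi_nep by (simp add: mi_nep_def bij_betw_def)
  ultimately show ?thesis
    using inj_onD[of _ _ "(\<nu>, i)" "(\<nu>', j)"] by fastforce
qed

lemma vars_cover: "\<exists>\<nu>. k \<in> vars G \<nu>"
proof -
  have "k \<in> (\<lambda>(\<nu>, j). coord G \<nu> j) ` (SIGMA \<nu>:UNIV. {1..nvar G \<nu>})"
    using mi_nep by (simp add: mi_nep_def bij_betw_def)
  then show ?thesis
    by (auto simp: vars_def)
qed

lemma part_part: "part G \<nu> (part G \<nu>' x) = (if \<nu> = \<nu>' then part G \<nu> x else 0)"
  using vars_disjoint by (auto simp: part_def vec_eq_iff)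

lemma sum_part: "(\<Sum>\<nu>\<in>UNIV. part G \<nu> x) = x"
proof -
  have "(\<Sum>\<nu>\<in>UNIV. part G \<nu> x) $ k = x $ k" for k
  proof -
    obtain \<nu> where "k \<in> vars G \<nu>"
      using vars_cover by blast
    then have "part G \<nu>' x $ k = (if \<nu>' = \<nu> then x $ k else 0)" for \<nu>'
      using vars_disjoint by (auto simp: part_def)
    then show ?thesis
      by simp
  qed
  then show ?thesis
    by (simp add: vec_eq_iff)
qed

lemma part_combine:
  "part G \<nu>' (combine G \<nu> u x) = (if \<nu>' = \<nu> then part G \<nu> u else part G \<nu>' x)"
  by (simp add: combine_eq part_add part_diff part_part)

lemma feas_facts:
  "feas G \<nu> \<subseteq> strategies G \<nu>" "closed (feas G \<nu>)" "convex (feas G \<nu>)"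
  "mixed_feas G \<nu> \<noteq> {}"
  "convex_on (strategies G \<nu>) (\<lambda>u. cost G \<nu> (combine G \<nu> u x))"
  using mi_nep unfolding mi_nep_def by blast+

lemma part_feas: "u \<in> feas G \<nu> \<Longrightarrow> part G \<nu> u = u"
  using feas_facts(1) by (auto simp flip: strategies_iff)

lemma combine_profiles:
  assumes "u \<in> feas G \<nu>" "x \<in> profiles G"
  shows "combine G \<nu> u x \<in> profiles G"
  using assms by (auto simp: profiles_def part_combine part_feas)

lemma combine_diff:
  assumes "u \<in> feas G \<nu>" "v \<in> feas G \<nu>"
  shows "combine G \<nu> u x - combine G \<nu> v x = u - v"
  by (simp add: combine_eq part_feas[OF assms(1)] part_feas[OF assms(2)])

lemma convex_profiles: "convex (profiles G)"
  unfolding convex_alt profiles_def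
  using feas_facts(3)[unfolded convex_alt] by (auto simp: part_add part_scaleR)

lemma closed_mixed_feas: "closed (mixed_feas G \<nu>)"
proof -
  have "closed {u::real^'n. u $ k \<in> \<int>}" for k
    using continuous_closed_vimage[OF closed_Ints, of "\<lambda>u::real^'n. u $ k"]
    by (simp add: vimage_def continuous_intros)
  then have "closed (\<Inter>j\<in>{1..nint G \<nu>}. {u::real^'n. u $ coord G \<nu> j \<in> \<int>})"
    by blast
  moreover have "mixed_feas G \<nu> =
      feas G \<nu> \<inter> (\<Inter>j\<in>{1..nint G \<nu>}. {u. u $ coord G \<nu> j \<in> \<int>})"
    by (auto simp: mixed_feas_def)
  ultimately show ?thesis
    using feas_facts(2) by (simp add: closed_Int)
qed

section \<open>Strong monotonicity in one block, and solvability after a change of costs\<close>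

lemma inner_game_map:
  "game_map (G\<lparr>cost := \<theta>\<rparr>) x \<bullet> part G \<nu> d = gradient (\<theta> \<nu>) x \<bullet> part G \<nu> d"
proof -
  have "game_map (G\<lparr>cost := \<theta>\<rparr>) x \<bullet> part G \<nu> d =
      (\<Sum>\<nu>'\<in>UNIV. gradient (\<theta> \<nu>') x \<bullet> part G \<nu>' (part G \<nu> d))"
    by (simp add: game_map_def inner_sum_left part_inner_commute)
  also have "\<dots> = (\<Sum>\<nu>'\<in>UNIV. if \<nu>' = \<nu> then gradient (\<theta> \<nu>) x \<bullet> part G \<nu> d else 0)"
    by (rule sum.cong) (auto simp: part_part)
  finally show ?thesis
    by simp
qed

text \<open>The two profiles differ only in the block of \<open>\<nu>\<close>, so pairing with their
  difference singles out the gradient of that player in the game mapping. Taking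
  \<open>\<theta> = cost G\<close> covers the original game.\<close>

lemma own_gradient_strongly_monotone:
  assumes "strongly_monotone (G\<lparr>cost := \<theta>\<rparr>) c"
    and "x \<in> profiles G" "u \<in> feas G \<nu>" "v \<in> feas G \<nu>"
  shows "(gradient (\<theta> \<nu>) (combine G \<nu> u x) - gradient (\<theta> \<nu>) (combine G \<nu> v x)) \<bullet> (u - v)
    \<ge> c * (norm (u - v))\<^sup>2"
proof -
  have d: "part G \<nu> (u - v) = u - v"
    using assms(3,4) by (simp add: part_diff part_feas)
  have "(game_map (G\<lparr>cost := \<theta>\<rparr>) (combine G \<nu> u x) -
      game_map (G\<lparr>cost := \<theta>\<rparr>) (combine G \<nu> v x)) \<bullet> (combine G \<nu> u x - combine G \<nu> v x)
    \<ge> c * (norm (combine G \<nu> u x - combine G \<nu> v x))\<^sup>2"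
    using assms(1) combine_profiles[OF assms(3,2)] combine_profiles[OF assms(4,2)]
    by (simp add: strongly_monotone_def)
  moreover have "game_map (G\<lparr>cost := \<theta>\<rparr>) p \<bullet> (u - v) = gradient (\<theta> \<nu>) p \<bullet> (u - v)" for p
    using inner_game_map[of \<theta> p \<nu> "u - v"] by (simp only: d)
  ultimately show ?thesis
    by (simp only: combine_diff[OF assms(3,4)] inner_diff_left)
qed

lemma own_part_gradient_strongly_monotone:
  assumes "strongly_monotone (G\<lparr>cost := \<theta>\<rparr>) c"
    and "x \<in> profiles G" "u \<in> feas G \<nu>" "v \<in> feas G \<nu>"
  shows "(part G \<nu> (gradient (\<theta> \<nu>) (combine G \<nu> u x)) -
      part G \<nu> (gradient (\<theta> \<nu>) (combine G \<nu> v x))) \<bullet> (u - v) \<ge> c * (norm (u - v))\<^sup>2"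
proof -
  have "part G \<nu> (u - v) = u - v"
    using assms(3,4) by (simp add: part_diff part_feas)
  then show ?thesis
    using own_gradient_strongly_monotone[OF assms]
    by (simp add: part_inner_commute flip: part_diff)
qed

text \<open>The standing assumptions of the original game say nothing about the minimizers of new
  costs. Strong monotonicity supplies them: each own problem is strongly convex, so it has a
  solution over the mixed-integer set and exactly one over the continuous set, even if these are
  unbounded.\<close>

lemma mi_nep_cost_update:
  assumes "strongly_monotone (G\<lparr>cost := \<theta>\<rparr>) c"
    and "\<And>\<nu> x. \<theta> \<nu> differentiable (at x)"
    and "\<And>\<nu> x. convex_on (strategies G \<nu>) (\<lambda>u. \<theta> \<nu> (combine G \<nu> u x))"
  shows "mi_nep (G\<lparr>cost := \<theta>\<rparr>)"
proof -
  have "c > 0"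
    using assms(1) by (simp add: strongly_monotone_def)
  have "\<exists>u. is_arg_min (\<lambda>u. \<theta> \<nu> (combine G \<nu> u x)) (\<lambda>u. u \<in> mixed_feas G \<nu>) u"
    and "\<exists>!u. is_arg_min (\<lambda>u. \<theta> \<nu> (combine G \<nu> u x)) (\<lambda>u. u \<in> feas G \<nu>) u"
    if x: "x \<in> profiles G" for \<nu> x
  proof -
    note convex_game = own_cost_has_derivative[OF assms(2)] feas_facts(3) \<open>c > 0\<close>
      own_part_gradient_strongly_monotone[OF assms(1) x]
    have "mixed_feas G \<nu> \<subseteq> feas G \<nu>"
      by (auto simp: mixed_feas_def)
    then show "\<exists>u. is_arg_min (\<lambda>u. \<theta> \<nu> (combine G \<nu> u x)) (\<lambda>u. u \<in> mixed_feas G \<nu>) u"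
      by (intro strongly_convex_minimizer_exists[OF convex_game])
        (auto simp: closed_mixed_feas feas_facts)
    have "feas G \<nu> \<noteq> {}"
      using \<open>mixed_feas G \<nu> \<subseteq> feas G \<nu>\<close> feas_facts(4) by blast
    then have "\<exists>u. is_arg_min (\<lambda>u. \<theta> \<nu> (combine G \<nu> u x)) (\<lambda>u. u \<in> feas G \<nu>) u"
      by (intro strongly_convex_minimizer_exists[OF convex_game]) (auto simp: feas_facts)
    then show "\<exists>!u. is_arg_min (\<lambda>u. \<theta> \<nu> (combine G \<nu> u x)) (\<lambda>u. u \<in> feas G \<nu>) u"
      using strongly_convex_minimizer_unique[OF convex_game] by blast
  qed
  then show ?thesis
    using mi_nep assms(3) by (simp add: mi_nep_def)
qed

lemma best_response_is_arg_min:
  assumes "x \<in> profiles G"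
  shows "is_arg_min (\<lambda>u. cost G \<nu> (combine G \<nu> u x)) (\<lambda>u. u \<in> feas G \<nu>) (best_response G \<nu> x)"
proof -
  have "\<exists>!u. is_arg_min (\<lambda>u. cost G \<nu> (combine G \<nu> u x)) (\<lambda>u. u \<in> feas G \<nu>) u"
    using mi_nep assms by (simp add: mi_nep_def)
  then have "\<exists>u. is_arg_min (\<lambda>u. cost G \<nu> (combine G \<nu> u x)) (\<lambda>u. u \<in> feas G \<nu>) u"
    by (rule ex1_implies_ex)
  \<comment> \<open>\<open>best_response\<close> is a choice among minimizers, so existence of one
    makes it a minimizer.\<close>
  then show ?thesis
    unfolding best_response_def arg_min_on_def arg_min_def by (rule someI_ex)
qed

lemma best_response_variational_inequality:
  assumes "x \<in> profiles G" "\<And>x. cost G \<nu> differentiable (at x)" "v \<in> feas G \<nu>"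
  shows "gradient (cost G \<nu>) (combine G \<nu> (best_response G \<nu> x) x) \<bullet> (v - best_response G \<nu> x) \<ge> 0"
proof -
  let ?u = "best_response G \<nu> x"
  have "?u \<in> feas G \<nu>"
    using best_response_is_arg_min[OF assms(1)] by (simp add: is_arg_min_def)
  then have "part G \<nu> (v - ?u) = v - ?u"
    using assms(3) by (simp add: part_diff part_feas)
  then show ?thesis
    using minimizer_variational_inequality[OF own_cost_has_derivative[OF assms(2)] feas_facts(3)
        best_response_is_arg_min[OF assms(1)] assms(3)]
    by (simp add: part_inner_commute)
qed

section \<open>Bounds on the off-diagonal and diagonal Hessian blocks\<close>

lemma cross_gradient_bound:
  assumes C2: "twice_continuously_differentiable (cost G \<nu>)"
    and bdd: "\<And>\<nu>'. \<nu>' \<noteq> \<nu> \<Longrightarrow> bdd_above (coupling_norms G \<nu> \<nu>')"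
    and xy: "x \<in> profiles G" "y \<in> profiles G" "part G \<nu> x = part G \<nu> y"
    and w: "part G \<nu> w = w"
  shows "(gradient (cost G \<nu>) x - gradient (cost G \<nu>) y) \<bullet> w \<le>
    (\<Sum>\<nu>'\<in>UNIV - {\<nu>}. coupling G \<nu> \<nu>' * norm (part G \<nu>' (x - y))) * norm w"
proof -
  obtain t where t: "0 < t" "t < 1"
    and eq: "(gradient (cost G \<nu>) (y + (x - y)) - gradient (cost G \<nu>) y) \<bullet> w =
      w \<bullet> (hessian (cost G \<nu>) (y + t *\<^sub>R (x - y)) *v (x - y))"
    using gradient_increment_eq_hessian[OF C2] by blast
  define p where "p = y + t *\<^sub>R (x - y)"
  \<comment> \<open>The couplings are suprema over feasible profiles only, so the intermediate point
    has to be feasible; convexity ensures this.\<close>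
  have "p = (1 - t) *\<^sub>R y + t *\<^sub>R x"
    by (simp add: p_def algebra_simps)
  then have p: "p \<in> profiles G"
    using convex_profiles xy t by (simp add: convex_alt)
  have block: "w \<bullet> (hessian (cost G \<nu>) p *v part G \<nu>' (x - y)) \<le>
      coupling G \<nu> \<nu>' * norm (part G \<nu>' (x - y)) * norm w" if "\<nu>' \<noteq> \<nu>" for \<nu>'
  proof -
    let ?e = "part G \<nu>' (x - y)" and ?B = "hessian_block G \<nu> \<nu>' (cost G \<nu>) p"
    have "w \<bullet> (hessian (cost G \<nu>) p *v ?e) = w \<bullet> (?B *v ?e)"
      by (simp add: hessian_block_mult w flip: part_inner_commute)
    also have "\<dots> \<le> norm w * norm (?B *v ?e)"
      by (rule norm_cauchy_schwarz)
    also have "\<dots> \<le> norm w * (spectral_norm ?B * norm ?e)"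
      by (intro mult_left_mono norm_matrix_vector_mult_le norm_ge_zero)
    also have "\<dots> \<le> norm w * (coupling G \<nu> \<nu>' * norm ?e)"
    proof -
      have "spectral_norm ?B \<le> coupling G \<nu> \<nu>'"
        unfolding coupling_def
        by (rule cSup_upper[OF _ bdd[OF that]]) (use p in \<open>auto simp: coupling_norms_def\<close>)
      then show ?thesis
        by (intro mult_left_mono mult_right_mono norm_ge_zero)
    qed
    finally show ?thesis
      by (simp add: mult_ac)
  qed
  \<comment> \<open>The block of \<open>\<nu>\<close> vanishes because \<open>x\<close> and
    \<open>y\<close> agree there, so only off-diagonal Hessian blocks contribute.\<close>
  have sum_diff: "x - y = (\<Sum>\<nu>'\<in>UNIV - {\<nu>}. part G \<nu>' (x - y))"
    using sum_part[of "x - y"] xy(3) by (simp add: sum.remove[of UNIV \<nu>] part_diff)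
  have "w \<bullet> (hessian (cost G \<nu>) p *v (x - y)) =
      w \<bullet> (hessian (cost G \<nu>) p *v (\<Sum>\<nu>'\<in>UNIV - {\<nu>}. part G \<nu>' (x - y)))"
    by (rule arg_cong[OF sum_diff])
  also have "\<dots> = (\<Sum>\<nu>'\<in>UNIV - {\<nu>}. w \<bullet> (hessian (cost G \<nu>) p *v part G \<nu>' (x - y)))"
    by (simp only: linear_sum[OF matrix_vector_mul_linear] inner_sum_right)
  also have "\<dots> \<le> (\<Sum>\<nu>'\<in>UNIV - {\<nu>}. coupling G \<nu> \<nu>' * norm (part G \<nu>' (x - y)) * norm w)"
    by (rule sum_mono) (use block in auto)
  finally show ?thesis
    using eq by (simp add: p_def sum_distrib_right)
qed

text \<open>Strong monotonicity controls feasible directions only. Semidefiniteness on the whole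
  block comes instead from convexity of the cost in the own variables, by taking
  \<open>b = 0\<close> and \<open>m = 0\<close> in \<open>hessian_lower_bound\<close>.\<close>

lemma own_hessian_nonneg:
  assumes C2: "twice_continuously_differentiable (cost G \<nu>)"
  shows "quad_form (hessian_block G \<nu> \<nu> (cost G \<nu>) x) (part G \<nu> d) \<ge> 0"
proof -
  let ?d = "part G \<nu> d"
  have deriv: "(cost G \<nu> has_derivative (\<lambda>h. gradient (cost G \<nu>) x \<bullet> h)) (at x)" for x
    by (rule gradient_has_derivative)
      (use C2 in \<open>simp add: twice_continuously_differentiable_def differentiable_on_def\<close>)
  have "convex_on UNIV (\<lambda>t. cost G \<nu> (x + t *\<^sub>R (s *\<^sub>R ?d)))" for s
  proof (rule convex_onI)
    fix t r q :: real
    assume t: "0 < t" "t < 1"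
    \<comment> \<open>These are the own strategies of \<open>\<nu>\<close> along the line, so that
      convexity in the own variables applies to it.\<close>
    define a where "a r = part G \<nu> x + (r * s) *\<^sub>R ?d" for r
    have part_a: "part G \<nu> (a r) = a r" for r
      by (simp add: a_def part_add part_scaleR)
    have cost_a: "cost G \<nu> (combine G \<nu> (a r) x) = cost G \<nu> (x + r *\<^sub>R (s *\<^sub>R ?d))" for r
      by (simp add: combine_eq part_a) (simp add: a_def add.commute)
    have "a r \<in> strategies G \<nu>" for r
      by (simp add: part_a strategies_iff)
    then have "cost G \<nu> (combine G \<nu> ((1 - t) *\<^sub>R a r + t *\<^sub>R a q) x)
        \<le> (1 - t) * cost G \<nu> (combine G \<nu> (a r) x) + t * cost G \<nu> (combine G \<nu> (a q) x)"
      using feas_facts(5)[of \<nu> x] t by (intro convex_onD) auto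
    moreover have "(1 - t) *\<^sub>R a r + t *\<^sub>R a q = a ((1 - t) * r + t * q)"
      by (simp add: a_def algebra_simps)
    ultimately show "cost G \<nu> (x + ((1 - t) *\<^sub>R r + t *\<^sub>R q) *\<^sub>R (s *\<^sub>R ?d))
        \<le> (1 - t) * cost G \<nu> (x + r *\<^sub>R (s *\<^sub>R ?d)) + t * cost G \<nu> (x + q *\<^sub>R (s *\<^sub>R ?d))"
      by (simp only: cost_a real_scaleR_def)
  qed simp
  from convex_on_line_gradient_monotone[OF deriv this]
  have "(?d - 0) \<bullet> (hessian (cost G \<nu>) x *v (?d - 0)) \<ge> 0 * (norm (?d - 0))\<^sup>2"
    by (intro hessian_lower_bound[OF C2]) simp
  then show ?thesis
    by (simp add: quad_form_def hessian_block_mult flip: part_inner_commute)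
qed

text \<open>
  Since \<open>x\<close> may lie on the boundary of the feasible set, \<open>u - v\<close> need not be a feasible direction
  at \<open>x\<close>; the segments from \<open>u\<close> to \<open>v\<close> are therefore shrunk homothetically towards \<open>x\<close>.
\<close>

lemma own_hessian_lower_bound:
  assumes C2: "twice_continuously_differentiable (cost G \<nu>)"
    and mono: "strongly_monotone G \<mu>"
    and x: "x \<in> profiles G" and uv: "u \<in> feas G \<nu>" "v \<in> feas G \<nu>"
  shows "quad_form (hessian_block G \<nu> \<nu> (cost G \<nu>) x) (u - v) \<ge> \<mu> * (norm (u - v))\<^sup>2"
proof -
  let ?a = "u - part G \<nu> x" and ?b = "v - part G \<nu> x"
  have "(?a - ?b) \<bullet> (hessian (cost G \<nu>) x *v (?a - ?b)) \<ge> \<mu> * (norm (?a - ?b))\<^sup>2"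
  proof (rule hessian_lower_bound[OF C2])
    fix s :: real
    assume s: "0 < s" "s \<le> 1"
    define r where "r u = (1 - s) *\<^sub>R part G \<nu> x + s *\<^sub>R u" for u
    have r: "r u \<in> feas G \<nu>" if "u \<in> feas G \<nu>" for u
      using feas_facts(3)[of \<nu>] s that x by (simp add: r_def convex_alt profiles_def)
    have combine_r: "combine G \<nu> (r u) x = x + s *\<^sub>R (u - part G \<nu> x)" if "u \<in> feas G \<nu>" for u
      using part_feas[OF r[OF that]] by (simp add: combine_eq) (simp add: r_def algebra_simps)
    have "r u - r v = s *\<^sub>R (?a - ?b)"
      by (simp add: r_def algebra_simps)
    then show "(gradient (cost G \<nu>) (x + s *\<^sub>R ?a) - gradient (cost G \<nu>) (x + s *\<^sub>R ?b))
        \<bullet> (s *\<^sub>R (?a - ?b)) \<ge> \<mu> * (norm (s *\<^sub>R (?a - ?b)))\<^sup>2"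
      using own_gradient_strongly_monotone[of "cost G" \<mu> x "r u" \<nu> "r v"] mono x r uv
      by (simp add: combine_r)
  qed
  moreover have "part G \<nu> (u - v) = u - v"
    using uv by (simp add: part_diff part_feas)
  ultimately show ?thesis
    by (simp add: quad_form_def hessian_block_mult flip: part_inner_commute)
qed

text \<open>All data depend on \<open>\<nu>\<close>, so different players may use different
  perturbations. The sum \<open>\<mu> + \<kappa> \<nu> * m \<nu>\<close> is a strong monotonicity
  constant of the perturbed own gradient on feasible strategies, and the coupling hypothesis
  compares it with the influence of the other players.\<close>

theorem own_quadratic_perturbation:
  fixes \<kappa> m :: "'p \<Rightarrow> real" and B :: "'p \<Rightarrow> real^'n^'n" and b :: "'p \<Rightarrow> real^'n"
  defines "\<theta> \<equiv> \<lambda>\<nu> x. cost G \<nu> x + own_quadratic G \<nu> (\<kappa> \<nu>) (B \<nu>) (b \<nu>) x"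
  assumes C2: "\<And>\<nu>. twice_continuously_differentiable (cost G \<nu>)"
    and mono: "strongly_monotone G \<mu>"
    and bdd: "\<And>\<nu> \<nu>'. \<nu> \<noteq> \<nu>' \<Longrightarrow> bdd_above (coupling_norms G \<nu> \<nu>')"
    and "\<And>\<nu>. \<kappa> \<nu> \<ge> 0" "\<And>\<nu>. m \<nu> \<ge> 0" "\<alpha> > 0"
    and psd: "\<And>\<nu> d. quad_form (B \<nu>) (part G \<nu> d) \<ge> 0"
    and lower: "\<And>\<nu> u v. u \<in> feas G \<nu> \<Longrightarrow> v \<in> feas G \<nu> \<Longrightarrow>
      quad_form (B \<nu>) (u - v) \<ge> m \<nu> * (norm (u - v))\<^sup>2"
    and coupling_le: "\<And>\<nu>. (\<Sum>\<nu>'\<in>UNIV - {\<nu>}. coupling G \<nu> \<nu>') \<le> \<alpha> * (\<mu> + \<kappa> \<nu> * m \<nu>)"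
  shows "mi_nep (G\<lparr>cost := \<theta>\<rparr>)"
    and "strongly_monotone (G\<lparr>cost := \<theta>\<rparr>) \<mu>"
    and "\<And>z y \<nu>. z \<in> profiles G \<Longrightarrow> y \<in> profiles G \<Longrightarrow>
      norm (best_response (G\<lparr>cost := \<theta>\<rparr>) \<nu> z - best_response (G\<lparr>cost := \<theta>\<rparr>) \<nu> y)
        \<le> \<alpha> * (MAX \<nu>. norm (part G \<nu> z - part G \<nu> y))"
proof -
  let ?q = "\<lambda>\<nu>. gradient (own_quadratic G \<nu> (\<kappa> \<nu>) (B \<nu>) (b \<nu>))"
  have "\<mu> > 0"
    using mono by (simp add: strongly_monotone_def)
  have cost_diff: "cost G \<nu> differentiable (at x)" for \<nu> x
    using C2[of \<nu>] by (simp add: twice_continuously_differentiable_def differentiable_on_def)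
  have deriv: "(\<theta> \<nu> has_derivative (\<lambda>h. (gradient (cost G \<nu>) x + ?q \<nu> x) \<bullet> h)) (at x)" for \<nu> x
    unfolding \<theta>_def inner_add_left gradient_own_quadratic
    by (intro has_derivative_add gradient_has_derivative cost_diff own_quadratic_has_derivative)
  then have grad: "gradient (\<theta> \<nu>) x = gradient (cost G \<nu>) x + ?q \<nu> x" for \<nu> x
    by (rule gradient_eqI)
  have diff: "\<theta> \<nu> differentiable (at x)" for \<nu> x
    using deriv by (rule differentiableI)
  have q_eq: "?q \<nu> x = ?q \<nu> y" if "part G \<nu> x = part G \<nu> y" for \<nu> x y
    using that by (simp add: gradient_own_quadratic)
  \<comment> \<open>The perturbations add monotone terms, one in each block, so the constant
    \<open>\<mu>\<close> is preserved.\<close>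
  have "game_map (G\<lparr>cost := \<theta>\<rparr>) x = game_map G x + (\<Sum>\<nu>\<in>UNIV. part G \<nu> (?q \<nu> x))" for x
    by (simp add: game_map_def grad part_add sum.distrib)
  moreover have "part G \<nu> (?q \<nu> x) = ?q \<nu> x" for \<nu> x
    by (simp add: gradient_own_quadratic part_scaleR)
  ultimately have "(game_map (G\<lparr>cost := \<theta>\<rparr>) x - game_map (G\<lparr>cost := \<theta>\<rparr>) y) \<bullet> (x - y) =
      (game_map G x - game_map G y) \<bullet> (x - y) +
      (\<Sum>\<nu>\<in>UNIV. (?q \<nu> x - ?q \<nu> y) \<bullet> (x - y))" for x y
    by (simp add: inner_sum_left sum_subtractf inner_diff_left inner_add_left)
  moreover have "(\<Sum>\<nu>\<in>UNIV. (?q \<nu> x - ?q \<nu> y) \<bullet> (x - y)) \<ge> 0" for x y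
    unfolding gradient_own_quadratic_monotone
    by (intro sum_nonneg mult_nonneg_nonneg psd assms)
  ultimately show sm: "strongly_monotone (G\<lparr>cost := \<theta>\<rparr>) \<mu>"
    using mono unfolding strongly_monotone_def cost_update_simps
    by (intro conjI ballI) (simp_all add: add_increasing2)
  have "convex_on (strategies G \<nu>) (\<lambda>u. \<theta> \<nu> (combine G \<nu> u x))" for \<nu> x
    unfolding \<theta>_def
    by (intro convex_on_add feas_facts own_quadratic_convex psd assms)
  then show nep: "mi_nep (G\<lparr>cost := \<theta>\<rparr>)"
    by (rule mi_nep_cost_update[OF sm diff])
  then interpret bar: mi_nep_game "G\<lparr>cost := \<theta>\<rparr>"
    by unfold_locales
  fix z y \<nu>
  assume zy: "z \<in> profiles G" "y \<in> profiles G"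
  define u where "u = best_response (G\<lparr>cost := \<theta>\<rparr>) \<nu> z"
  define v where "v = best_response (G\<lparr>cost := \<theta>\<rparr>) \<nu> y"
  define M where "M = (MAX \<nu>. norm (part G \<nu> z - part G \<nu> y))"
  define c where "c = \<mu> + \<kappa> \<nu> * m \<nu>"
  have "c > 0"
    using \<open>\<mu> > 0\<close> assms(5,6) by (simp add: c_def add_pos_nonneg)
  have uv: "u \<in> feas G \<nu>" "v \<in> feas G \<nu>"
    using bar.best_response_is_arg_min[of _ \<nu>] zy
    by (simp_all add: u_def v_def is_arg_min_def)
  \<comment> \<open>The two equilibrium conditions live at \<open>p\<close> = (u, z) and
    \<open>r\<close> = (v, y). The mixed profile \<open>p'\<close> = (v, z) separates the change of
    the own strategy from the change of the rivals' strategies.\<close>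
  define p where "p = combine G \<nu> u z"
  define p' where "p' = combine G \<nu> v z"
  define r where "r = combine G \<nu> v y"
  have parts: "part G \<nu> p' = part G \<nu> r"
    by (simp add: p'_def r_def part_combine)
  have w: "part G \<nu> (u - v) = u - v"
    using uv by (simp add: part_diff part_feas)
  have pp': "p - p' = u - v"
    using uv by (simp add: p_def p'_def combine_diff)
  have "gradient (\<theta> \<nu>) p \<bullet> (v - u) \<ge> 0" "gradient (\<theta> \<nu>) r \<bullet> (u - v) \<ge> 0"
    using bar.best_response_variational_inequality[of z \<nu> v]
      bar.best_response_variational_inequality[of y \<nu> u] zy diff uv
    by (simp_all add: p_def r_def flip: u_def v_def)
  moreover have "(gradient (cost G \<nu>) p - gradient (cost G \<nu>) p') \<bullet> (u - v) \<ge>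
      \<mu> * (norm (u - v))\<^sup>2"
    using own_gradient_strongly_monotone[of "cost G" \<mu> z u \<nu> v] mono zy uv
    by (simp add: p_def p'_def)
  \<comment> \<open>The perturbation gradient sees only the own block, where \<open>r\<close> and
    \<open>p'\<close> coincide; thus \<open>r\<close> may be replaced by \<open>p'\<close>.\<close>
  moreover have "(?q \<nu> p - ?q \<nu> r) \<bullet> (u - v) \<ge> \<kappa> \<nu> * m \<nu> * (norm (u - v))\<^sup>2"
    using gradient_own_quadratic_monotone[of G \<nu> "\<kappa> \<nu>" "B \<nu>" "b \<nu>" p p'] q_eq[OF parts]
      mult_left_mono[OF lower[OF uv] assms(5)]
    by (simp add: pp' w mult.assoc)
  ultimately have "c * (norm (u - v))\<^sup>2 \<le>
      (gradient (cost G \<nu>) r - gradient (cost G \<nu>) p') \<bullet> (u - v)"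
    unfolding grad by (simp add: c_def inner_diff inner_add distrib_right)
  also have "\<dots> \<le> (\<Sum>\<nu>'\<in>UNIV - {\<nu>}. coupling G \<nu> \<nu>' * norm (part G \<nu>' (r - p'))) * norm (u - v)"
    by (rule cross_gradient_bound)
      (use C2 bdd zy uv parts w in \<open>auto simp: p'_def r_def combine_profiles\<close>)
  also have "\<dots> \<le> (\<Sum>\<nu>'\<in>UNIV - {\<nu>}. coupling G \<nu> \<nu>' * M) * norm (u - v)"
  proof (intro mult_right_mono sum_mono mult_left_mono norm_ge_zero)
    fix \<nu>'
    assume "\<nu>' \<in> UNIV - {\<nu>}"
    then have "norm (part G \<nu>' (r - p')) = norm (part G \<nu>' z - part G \<nu>' y)"
      by (simp add: p'_def r_def part_diff part_combine norm_minus_commute)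
    also have "\<dots> \<le> M"
      unfolding M_def by (rule Max_ge) auto
    finally show "norm (part G \<nu>' (r - p')) \<le> M" .
    \<comment> \<open>Nonnegativity of the coupling, a supremum of norms, uses \<open>z\<close> as
      an element of the index set.\<close>
    have "bdd_above (coupling_norms G \<nu> \<nu>')"
      using bdd[of \<nu> \<nu>'] \<open>\<nu>' \<in> UNIV - {\<nu>}\<close> by auto
    then have "spectral_norm (hessian_block G \<nu> \<nu>' (cost G \<nu>) z) \<le> coupling G \<nu> \<nu>'"
      unfolding coupling_def by (rule cSup_upper[rotated]) (use zy in \<open>auto simp: coupling_norms_def\<close>)
    then show "0 \<le> coupling G \<nu> \<nu>'"
      unfolding spectral_norm_def
      using onorm_pos_le[OF matrix_vector_mul_bounded_linear] order_trans by blast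
  qed
  also have "\<dots> = (\<Sum>\<nu>'\<in>UNIV - {\<nu>}. coupling G \<nu> \<nu>') * (M * norm (u - v))"
    by (simp add: sum_distrib_right mult.assoc)
  also have "\<dots> \<le> \<alpha> * c * (M * norm (u - v))"
  proof (intro mult_right_mono mult_nonneg_nonneg norm_ge_zero)
    show "0 \<le> M"
      unfolding M_def by (rule order_trans[OF norm_ge_zero Max_ge]) auto
  qed (use coupling_le in \<open>simp add: c_def\<close>)
  finally have "norm (u - v) * norm (u - v) \<le> \<alpha> * M * norm (u - v)"
    using \<open>c > 0\<close> by (simp add: power2_eq_square mult_ac)
  then show "norm (u - v) \<le> \<alpha> * M"
  \<comment> \<open>The factor \<open>norm (u - v)\<close> can be cancelled only if it is nonzero;
    otherwise \<open>M \<ge> 0\<close> gives the claim.\<close>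
  proof (cases "u = v")
    case True
    have "0 \<le> M"
      unfolding M_def by (rule order_trans[OF norm_ge_zero Max_ge]) auto
    then show ?thesis
      using True \<open>\<alpha> > 0\<close> by simp
  qed simp
qed

end

section \<open>The two perturbations as instances of the general quadratic\<close>

lemma proximal_cost_eq:
  "proximal_cost G \<mu> \<alpha> xbar \<nu> = (\<lambda>x. cost G \<nu> x +
    own_quadratic G \<nu> (max ((\<Sum>\<nu>'\<in>UNIV - {\<nu>}. coupling G \<nu> \<nu>') / \<alpha> - \<mu>) 0) (mat 1)
      (part G \<nu> xbar) x)"
  by (simp add: proximal_cost_def own_quadratic_def quad_form_def power2_norm_eq_inner fun_eq_iff
      Let_def)

lemma hessian_cost_eq:
  "hessian_cost G \<mu> \<alpha> xbar \<nu> = (\<lambda>x. cost G \<nu> x +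
    own_quadratic G \<nu> (max ((\<Sum>\<nu>'\<in>UNIV - {\<nu>}. coupling G \<nu> \<nu>') / (\<alpha> * \<mu>) - 1) 0)
      (hessian_block G \<nu> \<nu> (cost G \<nu>) xbar) 0 x)"
  by (simp add: hessian_cost_def own_quadratic_def fun_eq_iff Let_def)

theorem proposition3:
  fixes G Gbar :: "('p::finite, 'n::finite) game"
    and \<mu> \<alpha> :: real
    and xbar :: "real^'n"
    and \<theta>bar :: "'p \<Rightarrow> real^'n \<Rightarrow> real"
  assumes "mi_nep G"
    and "\<And>\<nu>. twice_continuously_differentiable (cost G \<nu>)"
    and "\<mu> > 0" and "strongly_monotone G \<mu>"
    and "0 < \<alpha>" and "\<alpha> < 1"
    and "xbar \<in> profiles G"
    and "\<And>\<nu> \<nu>'. \<nu> \<noteq> \<nu>' \<Longrightarrow> bdd_above (coupling_norms G \<nu> \<nu>')"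
    and "\<And>\<nu>. \<theta>bar \<nu> = proximal_cost G \<mu> \<alpha> xbar \<nu> \<or> \<theta>bar \<nu> = hessian_cost G \<mu> \<alpha> xbar \<nu>"
    and "Gbar = G\<lparr>cost := \<theta>bar\<rparr>"
  shows "mi_nep Gbar \<and>
    (\<exists>\<mu>'. strongly_monotone Gbar \<mu>') \<and>
    (\<forall>z\<in>profiles G. \<forall>y\<in>profiles G.
       (MAX \<nu>. norm (best_response Gbar \<nu> z - best_response Gbar \<nu> y))
         \<le> \<alpha> * (MAX \<nu>. norm (part G \<nu> z - part G \<nu> y)))"
proof -
  interpret mi_nep_game G
    using assms(1) by unfold_locales
  let ?S = "\<lambda>\<nu>. \<Sum>\<nu>'\<in>UNIV - {\<nu>}. coupling G \<nu> \<nu>'"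
  \<comment> \<open>Collecting the requirements for one player allows the case distinction to be
    made player by player before the data are chosen as functions of \<open>\<nu>\<close>.\<close>
  define suitable where "suitable \<nu> \<kappa> m B b \<longleftrightarrow>
      \<theta>bar \<nu> = (\<lambda>x. cost G \<nu> x + own_quadratic G \<nu> \<kappa> B b x) \<and> \<kappa> \<ge> 0 \<and> m \<ge> 0 \<and>
      (\<forall>d. quad_form B (part G \<nu> d) \<ge> 0) \<and>
      (\<forall>u\<in>feas G \<nu>. \<forall>v\<in>feas G \<nu>. quad_form B (u - v) \<ge> m * (norm (u - v))\<^sup>2) \<and>
      ?S \<nu> \<le> \<alpha> * (\<mu> + \<kappa> * m)" for \<nu> \<kappa> m B b
  have "\<exists>\<kappa> m B b. suitable \<nu> \<kappa> m B b" for \<nu>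
    using assms(9)[of \<nu>]
  proof
    assume eq: "\<theta>bar \<nu> = proximal_cost G \<mu> \<alpha> xbar \<nu>"
    show ?thesis
      unfolding suitable_def
    proof (intro exI conjI)
      show "\<theta>bar \<nu> = (\<lambda>x. cost G \<nu> x +
          own_quadratic G \<nu> (max (?S \<nu> / \<alpha> - \<mu>) 0) (mat 1) (part G \<nu> xbar) x)"
        using eq by (simp only: proximal_cost_eq)
      \<comment> \<open>The identity matrix has lower bound \<open>m = 1\<close>, so
        \<open>\<eta>\<close> adds directly to \<open>\<mu>\<close>.\<close>
      have "?S \<nu> / \<alpha> \<le> \<mu> + max (?S \<nu> / \<alpha> - \<mu>) 0"
        by linarith
      then show "?S \<nu> \<le> \<alpha> * (\<mu> + max (?S \<nu> / \<alpha> - \<mu>) 0 * 1)"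
        using \<open>0 < \<alpha>\<close> by (simp only: pos_divide_le_eq mult.commute mult_1_left mult_1_right)
    qed (simp_all add: quad_form_def power2_norm_eq_inner)
  next
    assume eq: "\<theta>bar \<nu> = hessian_cost G \<mu> \<alpha> xbar \<nu>"
    show ?thesis
      unfolding suitable_def
    proof (intro exI conjI)
      show "\<theta>bar \<nu> = (\<lambda>x. cost G \<nu> x + own_quadratic G \<nu> (max (?S \<nu> / (\<alpha> * \<mu>) - 1) 0)
          (hessian_block G \<nu> \<nu> (cost G \<nu>) xbar) 0 x)"
        using eq by (simp only: hessian_cost_eq)
      \<comment> \<open>Here \<open>m = \<mu>\<close>: strong monotonicity bounds the own Hessian
        block at \<open>xbar\<close> from below, and the constant becomes
        \<open>\<mu> * (1 + \<rho>)\<close>.\<close>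
      have "?S \<nu> / (\<alpha> * \<mu>) \<le> 1 + max (?S \<nu> / (\<alpha> * \<mu>) - 1) 0"
        by linarith
      then have "?S \<nu> \<le> (1 + max (?S \<nu> / (\<alpha> * \<mu>) - 1) 0) * (\<alpha> * \<mu>)"
        using \<open>0 < \<alpha>\<close> \<open>\<mu> > 0\<close> by (simp only: pos_divide_le_eq mult_pos_pos)
      also have "\<dots> = \<alpha> * (\<mu> + max (?S \<nu> / (\<alpha> * \<mu>) - 1) 0 * \<mu>)"
        by (simp only: distrib_left distrib_right mult_ac mult_1_left)
      finally show "?S \<nu> \<le> \<alpha> * (\<mu> + max (?S \<nu> / (\<alpha> * \<mu>) - 1) 0 * \<mu>)" .
    qed (use assms own_hessian_nonneg own_hessian_lower_bound in auto)
  qed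
  then obtain \<kappa> m B b where suitable: "\<And>\<nu>. suitable \<nu> (\<kappa> \<nu>) (m \<nu>) (B \<nu>) (b \<nu>)"
    by metis
  have \<theta>bar: "\<theta>bar = (\<lambda>\<nu> x. cost G \<nu> x + own_quadratic G \<nu> (\<kappa> \<nu>) (B \<nu>) (b \<nu>) x)"
    and pos: "\<And>\<nu>. \<kappa> \<nu> \<ge> 0" "\<And>\<nu>. m \<nu> \<ge> 0"
    and B: "\<And>\<nu> d. quad_form (B \<nu>) (part G \<nu> d) \<ge> 0"
      "\<And>\<nu> u v. u \<in> feas G \<nu> \<Longrightarrow> v \<in> feas G \<nu> \<Longrightarrow>
        quad_form (B \<nu>) (u - v) \<ge> m \<nu> * (norm (u - v))\<^sup>2"
    and S: "\<And>\<nu>. ?S \<nu> \<le> \<alpha> * (\<mu> + \<kappa> \<nu> * m \<nu>)"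
    using suitable unfolding suitable_def by (auto intro!: ext)
  note perturbation = own_quadratic_perturbation[where \<kappa> = \<kappa> and m = m and B = B and b = b
      and \<mu> = \<mu> and \<alpha> = \<alpha>, folded \<theta>bar, folded assms(10)]
  note facts = assms(2,4,5,8) pos B S
  have "mi_nep Gbar"
    by (rule perturbation; fact facts)
  moreover have "strongly_monotone Gbar \<mu>"
    by (rule perturbation; fact facts)
  moreover have "(MAX \<nu>. norm (best_response Gbar \<nu> z - best_response Gbar \<nu> y))
      \<le> \<alpha> * (MAX \<nu>. norm (part G \<nu> z - part G \<nu> y))"
    if zy: "z \<in> profiles G" "y \<in> profiles G" for z y
  proof (rule Max.boundedI)
    have "norm (best_response Gbar \<nu> z - best_response Gbar \<nu> y)
        \<le> \<alpha> * (MAX \<nu>. norm (part G \<nu> z - part G \<nu> y))" for \<nu>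
      by (rule perturbation; fact facts zy)
    then show "r \<le> \<alpha> * (MAX \<nu>. norm (part G \<nu> z - part G \<nu> y))"
      if "r \<in> range (\<lambda>\<nu>. norm (best_response Gbar \<nu> z - best_response Gbar \<nu> y))" for r
      using that by blast
  qed auto
  ultimately show ?thesis
    by blast
qed

end
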